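(* Let $\mathfrak{gh}(V,Z,\beta)$ be a reduced Heisenberg algebra over a field $\mathbb K$, and let $A$ be an abelian Lie algebra over $\mathbb K$. Let $\Sigma_\beta$ denote the group of all linear bijections $\sigma$ of $V$ onto itself whose induced map on $V\wedge V$ (given by $v\wedge w\mapsto\sigma(v)\wedge\sigma(w)$) maps $\ker\hat\beta$ onto $\ker\hat\beta$. For $\sigma\in\Sigma_\beta$, let $\sigma'$ denote the unique element of $\mathrm{GL}(Z)$ such that $\sigma'(\beta(u,v))=\beta(\sigma(u),\sigma(v))$ for all $u,v\in V$. Then the automorphisms of the Lie algebra $\mathfrak{gh}(V,Z,\beta)\times A$ are precisely the maps $$(v,z,a)\mapsto\bigl(\sigma(v),\ \sigma'(z)+\tau(v)+\zeta(a),\ \alpha(a)+\xi(v)\bigr),$$ where $\sigma\in\Sigma_\beta$, $\tau\in\mathrm{Hom}(V,Z)$, $\zeta\in\mathrm{Hom}(A,Z)$, $\alpha\in\mathrm{GL}(A)$ and $\xi\in\mathrm{Hom}(V,A)$ (all $\mathrm{Hom}$ and $\mathrm{GL}$ being $\mathbb K$-linear).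
   Context: Let $V,Z$ be vector spaces over a field $\mathbb K$ (of arbitrary characteristic) and $\beta\colon V\times V\to Z$ an alternating bilinear map. The generalized Heisenberg algebra $\mathfrak{gh}(V,Z,\beta)$ is the Lie algebra with underlying vector space $V\times Z$ and bracket $[(v,x),(w,y)]=(0,\beta(v,w))$. It is called a reduced Heisenberg algebra if $\beta(V\times V)$ generates the vector space $Z$ and $\{v\in V\mid \forall w\in V\colon\beta(v,w)=0\}=\{0\}$. The map $\hat\beta\colon V\wedge V\to Z$ is the unique linear map with $\hat\beta(v\wedge w)=\beta(v,w)$ for all $v,w\in V$. Automorphisms are $\mathbb K$-linear Lie algebra automorphisms. *)

theory Defs
  imports
    "HOL-Library.FuncSet"
    "HOL-Library.Poly_Mapping"
    "HOL-Library.Set_Algebras"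
    "HOL-Analysis.Product_Vector"
begin

text \<open>
  A vector space over a field is a type of class \<^class>\<open>ab_group_add\<close> together with a scalar
  multiplication satisfying \<^const>\<open>vector_space\<close>; no finiteness of dimension is assumed.
\<close>

definition GL :: "('k::field \<Rightarrow> 'v::ab_group_add \<Rightarrow> 'v) \<Rightarrow> ('v \<Rightarrow> 'v) set" where
  "GL s = {f. Vector_Spaces.linear s s f \<and> bij f}"

definition alternating_bilinear ::
  "('k::field \<Rightarrow> 'v::ab_group_add \<Rightarrow> 'v) \<Rightarrow> ('k \<Rightarrow> 'z::ab_group_add \<Rightarrow> 'z) \<Rightarrow> ('v \<Rightarrow> 'v \<Rightarrow> 'z) \<Rightarrow> bool" where
  "alternating_bilinear sV sZ \<beta> \<longleftrightarrow>
     (\<forall>v. Vector_Spaces.linear sV sZ (\<lambda>w. \<beta> v w)) \<and>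
     (\<forall>w. Vector_Spaces.linear sV sZ (\<lambda>v. \<beta> v w)) \<and>
     (\<forall>v. \<beta> v v = 0)"


section \<open>Lie algebras\<close>

locale lie_algebra = vector_space scale
  for scale :: "'k::field \<Rightarrow> 'g::ab_group_add \<Rightarrow> 'g" +
  fixes bracket :: "'g \<Rightarrow> 'g \<Rightarrow> 'g"
  assumes alternating_bilinear_bracket: "alternating_bilinear scale scale bracket"
    and jacobi: "bracket x (bracket y z) + bracket y (bracket z x) + bracket z (bracket x y) = 0"

locale abelian_lie_algebra = lie_algebra +
  assumes abelian: "bracket x y = 0"

definition lie_automorphisms ::
  "('k::field \<Rightarrow> 'g::ab_group_add \<Rightarrow> 'g) \<Rightarrow> ('g \<Rightarrow> 'g \<Rightarrow> 'g) \<Rightarrow> ('g \<Rightarrow> 'g) set" where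
  "lie_automorphisms s br = {\<phi> \<in> GL s. \<forall>x y. \<phi> (br x y) = br (\<phi> x) (\<phi> y)}"

text \<open>
  The scalar multiplication of a product of vector spaces is \<^const>\<open>module_prod.scale\<close>.
\<close>

definition prod_bracket ::
  "('g \<Rightarrow> 'g \<Rightarrow> 'g) \<Rightarrow> ('h \<Rightarrow> 'h \<Rightarrow> 'h) \<Rightarrow> 'g \<times> 'h \<Rightarrow> 'g \<times> 'h \<Rightarrow> 'g \<times> 'h" where
  "prod_bracket br1 br2 = (\<lambda>(x, a) (y, b). (br1 x y, br2 a b))"

definition gh_bracket ::
  "('v::zero \<Rightarrow> 'v \<Rightarrow> 'z) \<Rightarrow> 'v \<times> 'z \<Rightarrow> 'v \<times> 'z \<Rightarrow> 'v \<times> 'z" where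
  "gh_bracket \<beta> = (\<lambda>(v, x) (w, y). (0, \<beta> v w))"

locale reduced_heisenberg = V: vector_space sV + Z: vector_space sZ
  for sV :: "'k::field \<Rightarrow> 'v::ab_group_add \<Rightarrow> 'v"
  and sZ :: "'k \<Rightarrow> 'z::ab_group_add \<Rightarrow> 'z" +
  fixes \<beta> :: "'v \<Rightarrow> 'v \<Rightarrow> 'z"
  assumes alternating_bilinear: "alternating_bilinear sV sZ \<beta>"
    and generates: "Z.span {\<beta> v w | v w. True} = UNIV"
    and nondegenerate: "{v. \<forall>w. \<beta> v w = 0} = {0}"


section \<open>The exterior square\<close>

text \<open>
  \<open>V \<and> V\<close> is the quotient of the free vector space on \<open>V \<times> V\<close> by the subspace generated by the
  relations making \<open>(v, w) \<mapsto> v \<and> w\<close> bilinear and alternating.  Its elements are cosets; their sum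
  is the elementwise sum of sets.
\<close>

definition free_scale :: "'k::field \<Rightarrow> ('b \<Rightarrow>\<^sub>0 'k) \<Rightarrow> ('b \<Rightarrow>\<^sub>0 'k)" where
  "free_scale c = Poly_Mapping.map (\<lambda>x. c * x)"

abbreviation free_gen :: "'v \<Rightarrow> 'v \<Rightarrow> ('v \<times> 'v \<Rightarrow>\<^sub>0 'k::field)" where
  "free_gen v w \<equiv> Poly_Mapping.single (v, w) 1"

definition ext_relators ::
  "('k::field \<Rightarrow> 'v::ab_group_add \<Rightarrow> 'v) \<Rightarrow> ('v \<times> 'v \<Rightarrow>\<^sub>0 'k) set" where
  "ext_relators s =
     {free_gen (u + v) w - free_gen u w - free_gen v w | u v w. True} \<union>
     {free_gen u (v + w) - free_gen u v - free_gen u w | u v w. True} \<union>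
     {free_gen (s c v) w - free_scale c (free_gen v w) | c v w. True} \<union>
     {free_gen v (s c w) - free_scale c (free_gen v w) | c v w. True} \<union>
     {free_gen v v | v. True}"

definition ext_null ::
  "('k::field \<Rightarrow> 'v::ab_group_add \<Rightarrow> 'v) \<Rightarrow> ('v \<times> 'v \<Rightarrow>\<^sub>0 'k) set" where
  "ext_null s = module.span free_scale (ext_relators s)"

definition ext_space ::
  "('k::field \<Rightarrow> 'v::ab_group_add \<Rightarrow> 'v) \<Rightarrow> ('v \<times> 'v \<Rightarrow>\<^sub>0 'k) set set" where
  "ext_space s = range (\<lambda>x. x +o ext_null s)"

definition ext_scale ::
  "('k::field \<Rightarrow> 'v::ab_group_add \<Rightarrow> 'v) \<Rightarrow>
     'k \<Rightarrow> ('v \<times> 'v \<Rightarrow>\<^sub>0 'k) set \<Rightarrow> ('v \<times> 'v \<Rightarrow>\<^sub>0 'k) set" where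
  \<comment> \<open>the sum with \<^term>\<open>ext_null s\<close> matters only for \<open>c = 0\<close>\<close>
  "ext_scale s c X = free_scale c ` X + ext_null s"

definition wedge ::
  "('k::field \<Rightarrow> 'v::ab_group_add \<Rightarrow> 'v) \<Rightarrow> 'v \<Rightarrow> 'v \<Rightarrow> ('v \<times> 'v \<Rightarrow>\<^sub>0 'k) set" where
  "wedge s v w = free_gen v w +o ext_null s"

text \<open>
  Linear maps from \<open>V \<and> V\<close> to a vector space with carrier \<open>T\<close>; outside the carrier
  \<^term>\<open>ext_space s\<close> they take the default value \<^const>\<open>undefined\<close>, which makes them unique.
\<close>

definition ext_hom ::
  "('k::field \<Rightarrow> 'v::ab_group_add \<Rightarrow> 'v) \<Rightarrow> 't set \<Rightarrow> ('t \<Rightarrow> 't \<Rightarrow> 't) \<Rightarrow> ('k \<Rightarrow> 't \<Rightarrow> 't) \<Rightarrow>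
     (('v \<times> 'v \<Rightarrow>\<^sub>0 'k) set \<Rightarrow> 't) set" where
  "ext_hom s T addT scaleT =
     {f \<in> ext_space s \<rightarrow>\<^sub>E T.
        (\<forall>X\<in>ext_space s. \<forall>Y\<in>ext_space s. f (X + Y) = addT (f X) (f Y)) \<and>
        (\<forall>c. \<forall>X\<in>ext_space s. f (ext_scale s c X) = scaleT c (f X))}"

definition hat ::
  "('k::field \<Rightarrow> 'v::ab_group_add \<Rightarrow> 'v) \<Rightarrow> ('k \<Rightarrow> 'z::ab_group_add \<Rightarrow> 'z) \<Rightarrow> ('v \<Rightarrow> 'v \<Rightarrow> 'z) \<Rightarrow>
     ('v \<times> 'v \<Rightarrow>\<^sub>0 'k) set \<Rightarrow> 'z" where
  "hat sV sZ \<beta> = (THE f. f \<in> ext_hom sV UNIV (+) sZ \<and> (\<forall>v w. f (wedge sV v w) = \<beta> v w))"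

definition ker_hat ::
  "('k::field \<Rightarrow> 'v::ab_group_add \<Rightarrow> 'v) \<Rightarrow> ('k \<Rightarrow> 'z::ab_group_add \<Rightarrow> 'z) \<Rightarrow> ('v \<Rightarrow> 'v \<Rightarrow> 'z) \<Rightarrow>
     ('v \<times> 'v \<Rightarrow>\<^sub>0 'k) set set" where
  "ker_hat sV sZ \<beta> = {X \<in> ext_space sV. hat sV sZ \<beta> X = 0}"

definition ext_map ::
  "('k::field \<Rightarrow> 'v::ab_group_add \<Rightarrow> 'v) \<Rightarrow> ('v \<Rightarrow> 'v) \<Rightarrow>
     ('v \<times> 'v \<Rightarrow>\<^sub>0 'k) set \<Rightarrow> ('v \<times> 'v \<Rightarrow>\<^sub>0 'k) set" where
  "ext_map s \<sigma> = (THE f. f \<in> ext_hom s (ext_space s) (+) (ext_scale s) \<and>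
     (\<forall>v w. f (wedge s v w) = wedge s (\<sigma> v) (\<sigma> w)))"

definition Sigma_group ::
  "('k::field \<Rightarrow> 'v::ab_group_add \<Rightarrow> 'v) \<Rightarrow> ('k \<Rightarrow> 'z::ab_group_add \<Rightarrow> 'z) \<Rightarrow> ('v \<Rightarrow> 'v \<Rightarrow> 'z) \<Rightarrow>
     ('v \<Rightarrow> 'v) set" where
  "Sigma_group sV sZ \<beta> = {\<sigma> \<in> GL sV. ext_map sV \<sigma> ` ker_hat sV sZ \<beta> = ker_hat sV sZ \<beta>}"

definition sigma_prime ::
  "('k::field \<Rightarrow> 'z::ab_group_add \<Rightarrow> 'z) \<Rightarrow> ('v \<Rightarrow> 'v \<Rightarrow> 'z) \<Rightarrow> ('v \<Rightarrow> 'v) \<Rightarrow> 'z \<Rightarrow> 'z" where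
  "sigma_prime sZ \<beta> \<sigma> = (THE \<rho>. \<rho> \<in> GL sZ \<and> (\<forall>u v. \<rho> (\<beta> u v) = \<beta> (\<sigma> u) (\<sigma> v)))"


section \<open>Well-definedness\<close>

lemma lookup_free_scale [simp]:
  "Poly_Mapping.lookup (free_scale c x) p = c * Poly_Mapping.lookup x p"
  by (simp add: free_scale_def Poly_Mapping.map.rep_eq when_def)

lemma vector_space_free: "vector_space free_scale"
  by unfold_locales (auto intro!: poly_mapping_eqI simp: lookup_add algebra_simps)

interpretation free: vector_space free_scale
  by (rule vector_space_free)

lemma subspace_ext_null: "free.subspace (ext_null s)"
  unfolding ext_null_def by (rule free.subspace_span)

lemma ext_relators_null: "r \<in> ext_relators s \<Longrightarrow> r \<in> ext_null s"
  unfolding ext_null_def by (rule free.span_base)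

lemma in_coset_iff: "y \<in> x +o ext_null s \<longleftrightarrow> y - x \<in> ext_null s"
proof
  assume "y - x \<in> ext_null s"
  then have "x + (y - x) \<in> x +o ext_null s" by (rule set_plus_intro2)
  then show "y \<in> x +o ext_null s" by simp
qed (auto simp: elt_set_plus_def)

lemma coset_self: "x \<in> x +o ext_null s"
  by (simp add: in_coset_iff free.subspace_0[OF subspace_ext_null])

lemma coset_eq_iff: "x +o ext_null s = y +o ext_null s \<longleftrightarrow> x - y \<in> ext_null s"
proof
  assume "x +o ext_null s = y +o ext_null s"
  then show "x - y \<in> ext_null s"
    using coset_self[of x s] by (simp add: in_coset_iff)
next
  assume *: "x - y \<in> ext_null s"
  have "z - x \<in> ext_null s \<longleftrightarrow> z - y \<in> ext_null s" for z
    using free.subspace_add[OF subspace_ext_null _ *, of "z - x"]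
      free.subspace_diff[OF subspace_ext_null _ *, of "z - y"]
    by auto
  then show "x +o ext_null s = y +o ext_null s"
    by (auto simp: in_coset_iff)
qed

lemma coset_add: "(x +o ext_null s) + (y +o ext_null s) = (x + y) +o ext_null s"
proof (intro subset_antisym subsetI)
  fix z assume "z \<in> (x +o ext_null s) + (y +o ext_null s)"
  then obtain a b where z: "z = a + b" and ab: "a - x \<in> ext_null s" "b - y \<in> ext_null s"
    by (auto elim!: set_plus_elim simp: in_coset_iff)
  have "(a - x) + (b - y) \<in> ext_null s"
    by (rule free.subspace_add[OF subspace_ext_null ab])
  moreover have "(a - x) + (b - y) = z - (x + y)"
    unfolding z by simp
  ultimately show "z \<in> (x + y) +o ext_null s"
    unfolding in_coset_iff by simp
next
  fix z assume "z \<in> (x + y) +o ext_null s"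
  then have "z - y \<in> x +o ext_null s"
    by (simp add: in_coset_iff algebra_simps)
  then have "(z - y) + y \<in> (x +o ext_null s) + (y +o ext_null s)"
    by (intro set_plus_intro coset_self)
  then show "z \<in> (x +o ext_null s) + (y +o ext_null s)" by simp
qed

lemma coset_scale: "ext_scale s c (x +o ext_null s) = free_scale c x +o ext_null s"
proof (intro subset_antisym subsetI)
  fix z assume "z \<in> ext_scale s c (x +o ext_null s)"
  then obtain a n where z: "z = free_scale c a + n" and a: "a - x \<in> ext_null s" "n \<in> ext_null s"
    by (auto simp: ext_scale_def in_coset_iff elim!: set_plus_elim)
  have "free_scale c (a - x) + n \<in> ext_null s"
    by (intro free.subspace_add[OF subspace_ext_null] free.subspace_scale[OF subspace_ext_null] a)
  moreover have "free_scale c (a - x) + n = z - free_scale c x"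
    unfolding z free.scale_right_diff_distrib by simp
  ultimately show "z \<in> free_scale c x +o ext_null s"
    unfolding in_coset_iff by simp
next
  fix z assume "z \<in> free_scale c x +o ext_null s"
  then have "free_scale c x + (z - free_scale c x) \<in> ext_scale s c (x +o ext_null s)"
    unfolding ext_scale_def in_coset_iff by (intro set_plus_intro imageI coset_self)
  then show "z \<in> ext_scale s c (x +o ext_null s)" by simp
qed

lemma coset_in_ext_space [simp]: "x +o ext_null s \<in> ext_space s"
  by (simp add: ext_space_def)

lemma wedge_in_ext_space [simp]: "wedge s v w \<in> ext_space s"
  by (simp add: wedge_def)

lemma poly_mapping_induct_single:
  fixes x :: "'b \<Rightarrow>\<^sub>0 'k::field"
  assumes "\<And>p c. P (Poly_Mapping.single p c)"
    and "\<And>x y. P x \<Longrightarrow> P y \<Longrightarrow> P (x + y)"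
  shows "P x"
proof (induction x rule: update_induct)
  case const
  show ?case using assms(1)[of undefined 0] by simp
next
  case (update x p c)
  have "Poly_Mapping.update p c x = x + Poly_Mapping.single p c"
    using update(1) by (intro poly_mapping_eqI)
      (auto simp: lookup_update lookup_add lookup_single when_def in_keys_iff)
  then show ?case using assms update by simp
qed

lemma ext_hom_eqI:
  assumes f: "f \<in> ext_hom s T addT scaleT" and g: "g \<in> ext_hom s T addT scaleT"
    and eq: "\<And>v w. f (wedge s v w) = g (wedge s v w)"
  shows "f = g"
proof -
  have "f (x +o ext_null s) = g (x +o ext_null s)" for x
  proof (induction x rule: poly_mapping_induct_single)
    case (1 p c)
    obtain v w where p: "p = (v, w)" by fastforce
    have "Poly_Mapping.single p c +o ext_null s = ext_scale s c (wedge s v w)"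
      unfolding wedge_def coset_scale by (simp add: p free_scale_def)
    then show ?case using f g eq[of v w] by (simp add: ext_hom_def)
  next
    case (2 x y)
    then show ?case using f g unfolding ext_hom_def coset_add[symmetric] by simp
  qed
  then have "f X = g X" if "X \<in> ext_space s" for X
    using that by (auto simp: ext_space_def)
  moreover have "f \<in> extensional (ext_space s)" "g \<in> extensional (ext_space s)"
    using f g by (auto simp: ext_hom_def PiE_def)
  ultimately show ?thesis by (auto intro: extensionalityI)
qed

definition free_lift ::
  "('k::field \<Rightarrow> 'z::ab_group_add \<Rightarrow> 'z) \<Rightarrow> ('b \<Rightarrow> 'z) \<Rightarrow> ('b \<Rightarrow>\<^sub>0 'k) \<Rightarrow> 'z" where
  "free_lift s g x = (\<Sum>p\<in>Poly_Mapping.keys x. s (Poly_Mapping.lookup x p) (g p))"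

context vector_space
begin

lemma free_lift_mono:
  assumes "finite A" "Poly_Mapping.keys x \<subseteq> A"
  shows "free_lift scale g x = (\<Sum>p\<in>A. scale (Poly_Mapping.lookup x p) (g p))"
  unfolding free_lift_def
  by (rule sum.mono_neutral_left) (use assms in \<open>auto simp: in_keys_iff\<close>)

lemma linear_free_lift: "Vector_Spaces.linear free_scale scale (free_lift scale g)"
proof -
  have "free_lift scale g (x + y) = free_lift scale g x + free_lift scale g y" for x y
  proof -
    let ?A = "Poly_Mapping.keys x \<union> Poly_Mapping.keys y"
    have "Poly_Mapping.keys (x + y) \<subseteq> ?A" by (rule keys_add)
    then show ?thesis
      by (simp add: free_lift_mono[of ?A] lookup_add scale_left_distrib sum.distrib)
  qed
  moreover have "free_lift scale g (free_scale c x) = scale c (free_lift scale g x)" for c x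
  proof -
    have "Poly_Mapping.keys (free_scale c x) \<subseteq> Poly_Mapping.keys x"
      by (auto simp: in_keys_iff)
    then show ?thesis
      by (simp add: free_lift_mono[of "Poly_Mapping.keys x"] scale_sum_right)
  qed
  ultimately show ?thesis
    by (intro Vector_Spaces.linear.intro module_hom.intro module_hom_axioms.intro vector_space_free
        free.module_axioms vector_space_axioms module_axioms)
qed

lemma free_lift_single [simp]: "free_lift scale g (Poly_Mapping.single p 1) = g p"
  by (simp add: free_lift_def)

end

lemma ext_null_into:
  assumes f: "Vector_Spaces.linear free_scale sT f" and T: "module.subspace sT T"
    and rel: "\<And>r. r \<in> ext_relators s \<Longrightarrow> f r \<in> T"
    and x: "x \<in> ext_null s"
  shows "f x \<in> T"
proof -
  interpret f: Vector_Spaces.linear free_scale sT f by (rule f)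
  have "free.subspace {x. f x \<in> T}"
    by (rule free.subspaceI)
      (auto simp: f.add f.scale f.zero
        intro: f.vs2.subspace_0[OF T] f.vs2.subspace_add[OF T] f.vs2.subspace_scale[OF T])
  then have "ext_null s \<subseteq> {x. f x \<in> T}"
    unfolding ext_null_def using rel by (intro free.span_minimal) auto
  then show ?thesis using x by auto
qed

lemma hat_exists:
  assumes ab: "alternating_bilinear sV sZ \<beta>"
  shows "\<exists>f. f \<in> ext_hom sV UNIV (+) sZ \<and> (\<forall>v w. f (wedge sV v w) = \<beta> v w) \<and>
    (\<forall>x. f (x +o ext_null sV) = free_lift sZ (\<lambda>(v, w). \<beta> v w) x)"
proof -
  have l1: "Vector_Spaces.linear sV sZ (\<lambda>w. \<beta> v w)" for v
    using ab by (simp add: alternating_bilinear_def)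
  have l2: "Vector_Spaces.linear sV sZ (\<lambda>v. \<beta> v w)" for w
    using ab by (simp add: alternating_bilinear_def)
  interpret Z: vector_space sZ using l1[of 0] by (simp add: Vector_Spaces.linear_def)
  note lin = l1[unfolded Vector_Spaces.linear_def module_hom_def module_hom_axioms_def]
    l2[unfolded Vector_Spaces.linear_def module_hom_def module_hom_axioms_def]
  define F where "F = free_lift sZ (\<lambda>(v, w). \<beta> v w)"
  interpret F: Vector_Spaces.linear free_scale sZ F
    unfolding F_def by (rule Z.linear_free_lift)
  have gen [simp]: "F (free_gen v w) = \<beta> v w" for v w
    by (simp add: F_def)
  have null: "F x = 0" if "x \<in> ext_null sV" for x
  proof -
    have "F r \<in> {0}" if "r \<in> ext_relators sV" for r
      using that ab lin
      by (auto simp: ext_relators_def F.diff F.scale alternating_bilinear_def)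
    then show ?thesis
      using ext_null_into[OF F.linear_axioms Z.subspace_single_0 _ that] by auto
  qed
  define h where "h = (\<lambda>X\<in>ext_space sV. F (SOME x. x \<in> X))"
  have hF: "h (x +o ext_null sV) = F x" for x
  proof -
    have "x + 0 \<in> x +o ext_null sV"
      by (rule set_plus_intro2, rule free.subspace_0[OF subspace_ext_null])
    then have "(SOME y. y \<in> x +o ext_null sV) \<in> x +o ext_null sV" by (rule someI)
    then obtain n where "n \<in> ext_null sV" "(SOME y. y \<in> x +o ext_null sV) = x + n"
      by (auto simp: elt_set_plus_def)
    then show ?thesis by (simp add: h_def F.add null)
  qed
  have "h \<in> ext_hom sV UNIV (+) sZ"
    unfolding ext_hom_def
    by (auto simp: ext_space_def coset_add coset_scale hF F.add F.scale)
      (auto simp: h_def ext_space_def)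
  moreover have "h (wedge sV v w) = \<beta> v w" for v w
    by (simp add: wedge_def hF)
  ultimately show ?thesis
    using hF unfolding F_def by blast
qed

lemma ex1_hat:
  assumes "alternating_bilinear sV sZ \<beta>"
  shows "\<exists>!f. f \<in> ext_hom sV UNIV (+) sZ \<and> (\<forall>v w. f (wedge sV v w) = \<beta> v w)"
proof -
  obtain h where "h \<in> ext_hom sV UNIV (+) sZ" "\<forall>v w. h (wedge sV v w) = \<beta> v w"
    using hat_exists[OF assms] by blast
  then show ?thesis
    by (intro ex1I[of _ h]) (auto intro: ext_hom_eqI)
qed

lemma hat_coset:
  assumes "alternating_bilinear sV sZ \<beta>"
  shows "hat sV sZ \<beta> (x +o ext_null sV) = free_lift sZ (\<lambda>(v, w). \<beta> v w) x"
proof -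
  obtain h where h: "h \<in> ext_hom sV UNIV (+) sZ \<and> (\<forall>v w. h (wedge sV v w) = \<beta> v w)"
    and eq: "\<forall>x. h (x +o ext_null sV) = free_lift sZ (\<lambda>(v, w). \<beta> v w) x"
    using hat_exists[OF assms] by blast
  have "hat sV sZ \<beta> = h"
    unfolding hat_def by (intro the1_equality ex1_hat[OF assms] h)
  then show ?thesis using eq by simp
qed

lemma ext_map_exists:
  assumes \<sigma>: "Vector_Spaces.linear s s \<sigma>"
  shows "\<exists>f. f \<in> ext_hom s (ext_space s) (+) (ext_scale s) \<and>
    (\<forall>v w. f (wedge s v w) = wedge s (\<sigma> v) (\<sigma> w)) \<and>
    (\<forall>x. f (x +o ext_null s) =
       free_lift free_scale (\<lambda>(v, w). free_gen (\<sigma> v) (\<sigma> w)) x +o ext_null s) \<and>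
    (\<forall>x\<in>ext_null s. free_lift free_scale (\<lambda>(v, w). free_gen (\<sigma> v) (\<sigma> w)) x \<in> ext_null s)"
proof -
  interpret \<sigma>: Vector_Spaces.linear s s \<sigma> by (rule \<sigma>)
  define F :: "('b \<times> 'b \<Rightarrow>\<^sub>0 'a) \<Rightarrow> _" where
    "F = free_lift free_scale (\<lambda>(v, w). free_gen (\<sigma> v) (\<sigma> w))"
  interpret F: Vector_Spaces.linear free_scale free_scale F
    unfolding F_def by (rule free.linear_free_lift)
  have gen [simp]: "F (free_gen v w) = free_gen (\<sigma> v) (\<sigma> w)" for v w
    by (simp add: F_def)
  have null: "F x \<in> ext_null s" if "x \<in> ext_null s" for x
  proof -
    have "F r \<in> ext_relators s" if "r \<in> ext_relators s" for r
      using that unfolding ext_relators_def Un_iff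
      by (elim disjE) (auto simp: F.diff F.scale \<sigma>.add \<sigma>.scale, blast+)
    then show ?thesis
      using ext_null_into[OF F.linear_axioms subspace_ext_null _ that] ext_relators_null by metis
  qed
  define h where "h = (\<lambda>X\<in>ext_space s. F (SOME x. x \<in> X) +o ext_null s)"
  have hF: "h (x +o ext_null s) = F x +o ext_null s" for x
  proof -
    have "x + 0 \<in> x +o ext_null s"
      by (rule set_plus_intro2, rule free.subspace_0[OF subspace_ext_null])
    then have "(SOME y. y \<in> x +o ext_null s) \<in> x +o ext_null s" by (rule someI)
    then obtain n where "n \<in> ext_null s" "(SOME y. y \<in> x +o ext_null s) = x + n"
      by (auto simp: elt_set_plus_def)
    then show ?thesis by (simp add: h_def F.add null coset_eq_iff)
  qed
  have "h \<in> ext_hom s (ext_space s) (+) (ext_scale s)"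
    unfolding ext_hom_def
    by (auto simp: ext_space_def coset_add coset_scale hF F.add F.scale)
      (auto simp: h_def ext_space_def)
  moreover have "h (wedge s v w) = wedge s (\<sigma> v) (\<sigma> w)" for v w
    by (simp add: wedge_def hF)
  ultimately show ?thesis
    using hF null unfolding F_def by blast
qed

lemma ex1_ext_map:
  assumes "Vector_Spaces.linear s s \<sigma>"
  shows "\<exists>!f. f \<in> ext_hom s (ext_space s) (+) (ext_scale s) \<and>
    (\<forall>v w. f (wedge s v w) = wedge s (\<sigma> v) (\<sigma> w))"
proof -
  obtain h where "h \<in> ext_hom s (ext_space s) (+) (ext_scale s)"
    "\<forall>v w. h (wedge s v w) = wedge s (\<sigma> v) (\<sigma> w)"
    using ext_map_exists[OF assms] by blast
  then show ?thesis
    by (intro ex1I[of _ h]) (auto intro: ext_hom_eqI)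
qed

lemma ext_map_coset:
  assumes "Vector_Spaces.linear s s \<sigma>"
  shows "ext_map s \<sigma> (x +o ext_null s) =
    free_lift free_scale (\<lambda>(v, w). free_gen (\<sigma> v) (\<sigma> w)) x +o ext_null s"
proof -
  obtain h where h: "h \<in> ext_hom s (ext_space s) (+) (ext_scale s) \<and>
      (\<forall>v w. h (wedge s v w) = wedge s (\<sigma> v) (\<sigma> w))"
    and eq: "\<forall>x. h (x +o ext_null s) =
      free_lift free_scale (\<lambda>(v, w). free_gen (\<sigma> v) (\<sigma> w)) x +o ext_null s"
    using ext_map_exists[OF assms] by blast
  have "ext_map s \<sigma> = h"
    unfolding ext_map_def by (intro the1_equality ex1_ext_map[OF assms] h)
  then show ?thesis using eq by simp
qed

lemma linear_free_eqI:
  assumes "Vector_Spaces.linear free_scale sT f" "Vector_Spaces.linear free_scale sT g"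
    and "\<And>p. f (Poly_Mapping.single p 1) = g (Poly_Mapping.single p 1)"
  shows "f x = g x"
proof -
  interpret f: Vector_Spaces.linear free_scale sT f by fact
  interpret g: Vector_Spaces.linear free_scale sT g by fact
  show ?thesis
  proof (induction x rule: poly_mapping_induct_single)
    case (1 p c)
    have "Poly_Mapping.single p c = free_scale c (Poly_Mapping.single p 1)"
      by (simp add: free_scale_def)
    then show ?case using assms(3) by (simp add: f.scale g.scale)
  qed (simp add: f.add g.add)
qed

context reduced_heisenberg
begin

lemma ex1_sigma_prime:
  assumes "\<sigma> \<in> Sigma_group sV sZ \<beta>"
  shows "\<exists>!\<rho>. \<rho> \<in> GL sZ \<and> (\<forall>u v. \<rho> (\<beta> u v) = \<beta> (\<sigma> u) (\<sigma> v))"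
proof -
  have \<sigma>: "Vector_Spaces.linear sV sV \<sigma>" "bij \<sigma>"
    and ker: "ext_map sV \<sigma> ` ker_hat sV sZ \<beta> = ker_hat sV sZ \<beta>"
    using assms by (auto simp: Sigma_group_def GL_def)
  interpret \<sigma>: Vector_Spaces.linear sV sV \<sigma> by (rule \<sigma>)
  define \<sigma>' where "\<sigma>' = inv \<sigma>"
  have inv [simp]: "\<sigma> (\<sigma>' v) = v" "\<sigma>' (\<sigma> v) = v" for v
    using \<sigma>(2) by (auto simp: \<sigma>'_def bij_is_surj surj_f_inv_f bij_is_inj inv_f_f)
  have \<sigma>': "Vector_Spaces.linear sV sV \<sigma>'"
  proof -
    have "\<sigma>' (u + v) = \<sigma>' u + \<sigma>' v" for u v
      by (metis inv \<sigma>.add)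
    moreover have "\<sigma>' (sV c v) = sV c (\<sigma>' v)" for c v
      by (metis inv \<sigma>.scale)
    ultimately show ?thesis
      by (intro Vector_Spaces.linear.intro module_hom.intro module_hom_axioms.intro
          V.vector_space_axioms V.module_axioms)
  qed
  define B where "B = free_lift sZ (\<lambda>(v, w). \<beta> v w)"
  define S :: "('v \<times> 'v \<Rightarrow>\<^sub>0 'k) \<Rightarrow> _" where
    "S = free_lift free_scale (\<lambda>(v, w). free_gen (\<sigma> v) (\<sigma> w))"
  define S' :: "('v \<times> 'v \<Rightarrow>\<^sub>0 'k) \<Rightarrow> _" where
    "S' = free_lift free_scale (\<lambda>(v, w). free_gen (\<sigma>' v) (\<sigma>' w))"
  interpret B: Vector_Spaces.linear free_scale sZ B
    unfolding B_def by (rule Z.linear_free_lift)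
  interpret S: Vector_Spaces.linear free_scale free_scale S
    unfolding S_def by (rule free.linear_free_lift)
  interpret S': Vector_Spaces.linear free_scale free_scale S'
    unfolding S'_def by (rule free.linear_free_lift)
  have gen [simp]: "B (free_gen v w) = \<beta> v w" "S (free_gen v w) = free_gen (\<sigma> v) (\<sigma> w)"
    "S' (free_gen v w) = free_gen (\<sigma>' v) (\<sigma>' w)" for v w
    by (simp_all add: B_def S_def S'_def)
  have S'S [simp]: "S' (S x) = x" for x
  proof -
    have "(S' \<circ> S) x = id x"
    proof (rule linear_free_eqI[where f = "S' \<circ> S" and g = id and sT = free_scale])
      show "Vector_Spaces.linear free_scale free_scale (S' \<circ> S)"
        by (rule Vector_Spaces.linear_compose[OF S.linear_axioms S'.linear_axioms])
      show "Vector_Spaces.linear free_scale free_scale (id :: ('v \<times> 'v \<Rightarrow>\<^sub>0 'k) \<Rightarrow> _)"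
        by (rule free.linear_id)
    qed (auto simp: split_paired_all)
    then show ?thesis by simp
  qed
  have SS' [simp]: "S (S' x) = x" for x
  proof -
    have "(S \<circ> S') x = id x"
    proof (rule linear_free_eqI[where f = "S \<circ> S'" and g = id and sT = free_scale])
      show "Vector_Spaces.linear free_scale free_scale (S \<circ> S')"
        by (rule Vector_Spaces.linear_compose[OF S'.linear_axioms S.linear_axioms])
      show "Vector_Spaces.linear free_scale free_scale (id :: ('v \<times> 'v \<Rightarrow>\<^sub>0 'k) \<Rightarrow> _)"
        by (rule free.linear_id)
    qed (auto simp: split_paired_all)
    then show ?thesis by simp
  qed
  have hat: "hat sV sZ \<beta> (x +o ext_null sV) = B x" for x
    unfolding B_def by (rule hat_coset[OF alternating_bilinear])
  have ext: "ext_map sV \<sigma> (x +o ext_null sV) = S x +o ext_null sV" for x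
    unfolding S_def by (rule ext_map_coset[OF \<sigma>(1)])
  have null': "S' x \<in> ext_null sV" if "x \<in> ext_null sV" for x
    using ext_map_exists[OF \<sigma>'] that unfolding S'_def by blast
  have in_ker: "x +o ext_null sV \<in> ker_hat sV sZ \<beta> \<longleftrightarrow> B x = 0" for x
    by (simp add: ker_hat_def hat)
  have Bcoset: "B x = B y" if "x - y \<in> ext_null sV" for x y
    using that by (metis coset_eq_iff hat)
  have BS: "B (S x) = 0 \<longleftrightarrow> B x = 0" for x
  proof
    assume "B x = 0"
    then have "x +o ext_null sV \<in> ker_hat sV sZ \<beta>" by (simp add: in_ker)
    then have "ext_map sV \<sigma> (x +o ext_null sV) \<in> ker_hat sV sZ \<beta>" using ker by blast
    then show "B (S x) = 0" by (simp add: ext in_ker)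
  next
    assume "B (S x) = 0"
    then have "S x +o ext_null sV \<in> ext_map sV \<sigma> ` ker_hat sV sZ \<beta>"
      unfolding ker in_ker .
    then obtain y where y: "B y = 0" "S x +o ext_null sV = S y +o ext_null sV"
      by (auto simp: ker_hat_def ext_space_def hat ext)
    then have "S' (S x - S y) \<in> ext_null sV"
      by (intro null') (simp add: coset_eq_iff)
    then have "x - y \<in> ext_null sV" by (simp add: S'.diff)
    then show "B x = 0" using Bcoset y by metis
  qed
  have "Z.subspace (range B)"
    by (rule B.subspace_image) (rule free.subspace_UNIV)
  moreover have "{\<beta> v w |v w. True} \<subseteq> range B"
    using gen(1) by (auto simp del: gen(1) simp: gen(1)[symmetric])
  ultimately have surj: "surj B"
    using Z.span_minimal generates by blast
  define \<rho> where "\<rho> z = B (S (SOME x. B x = z))" for z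
  have \<rho>B: "\<rho> (B x) = B (S x)" for x
  proof -
    have "B (SOME y. B y = B x) = B x" by (rule someI) simp
    then have "B ((SOME y. B y = B x) - x) = 0" by (simp add: B.diff)
    then have "B (S ((SOME y. B y = B x) - x)) = 0" by (simp only: BS)
    then show ?thesis by (simp add: \<rho>_def S.diff B.diff)
  qed
  have lin: "Vector_Spaces.linear sZ sZ \<rho>"
  proof -
    have "\<rho> (y + z) = \<rho> y + \<rho> z" for y z
    proof -
      obtain a b where "y = B a" "z = B b" using surj by (meson surjD)
      then show ?thesis using \<rho>B[of "a + b"] by (simp add: \<rho>B B.add S.add)
    qed
    moreover have "\<rho> (sZ c z) = sZ c (\<rho> z)" for c z
    proof -
      obtain b where "z = B b" using surj by (meson surjD)
      then show ?thesis using \<rho>B[of "free_scale c b"] by (simp add: \<rho>B B.scale S.scale)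
    qed
    ultimately show ?thesis
      by (intro Vector_Spaces.linear.intro module_hom.intro module_hom_axioms.intro
          Z.vector_space_axioms Z.module_axioms)
  qed
  interpret \<rho>: Vector_Spaces.linear sZ sZ \<rho> by (rule lin)
  have "z = 0" if "\<rho> z = 0" for z
  proof -
    obtain x where "z = B x" using surj by (meson surjD)
    with that show ?thesis by (simp add: \<rho>B BS)
  qed
  then have "inj \<rho>" by (simp add: \<rho>.inj_iff_eq_0)
  moreover have "surj \<rho>"
  proof (rule surjI)
    fix z
    have "B (SOME x. B x = z) = z"
      by (rule someI_ex) (use surj in \<open>metis surjD\<close>)
    then show "\<rho> (B (S' (SOME x. B x = z))) = z" by (simp add: \<rho>B)
  qed
  ultimately have "\<rho> \<in> GL sZ" using lin by (simp add: GL_def bij_def)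
  moreover have "\<rho> (\<beta> u v) = \<beta> (\<sigma> u) (\<sigma> v)" for u v
    using \<rho>B[of "free_gen u v"] by simp
  moreover have "\<rho>' = \<rho>"
    if "\<rho>' \<in> GL sZ" "\<forall>u v. \<rho>' (\<beta> u v) = \<beta> (\<sigma> u) (\<sigma> v)" for \<rho>'
  proof
    fix z
    interpret \<rho>': Vector_Spaces.linear sZ sZ \<rho>' using that(1) by (simp add: GL_def)
    obtain x where z: "z = B x" using surj by (meson surjD)
    have "(\<rho>' \<circ> B) x = (\<rho> \<circ> B) x"
    proof (rule linear_free_eqI[where f = "\<rho>' \<circ> B" and g = "\<rho> \<circ> B" and sT = sZ])
      show "Vector_Spaces.linear free_scale sZ (\<rho>' \<circ> B)"
        by (rule Vector_Spaces.linear_compose[OF B.linear_axioms \<rho>'.linear_axioms])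
      show "Vector_Spaces.linear free_scale sZ (\<rho> \<circ> B)"
        by (rule Vector_Spaces.linear_compose[OF B.linear_axioms \<rho>.linear_axioms])
      show "(\<rho>' \<circ> B) (Poly_Mapping.single p 1) = (\<rho> \<circ> B) (Poly_Mapping.single p 1)" for p
        using that(2) \<open>\<And>u v. \<rho> (\<beta> u v) = \<beta> (\<sigma> u) (\<sigma> v)\<close> by (cases p) simp
    qed
    then show "\<rho>' z = \<rho> z" by (simp add: z)
  qed
  ultimately show ?thesis by blast
qed

end

lemma vs_linear_iff:
  "Vector_Spaces.linear s1 s2 f \<longleftrightarrow> vector_space s1 \<and> vector_space s2 \<and>
     (\<forall>x y. f (x + y) = f x + f y) \<and> (\<forall>c x. f (s1 c x) = s2 c (f x))"
  by (auto simp: Vector_Spaces.linear_def module_hom_def module_hom_axioms_def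
      module_iff_vector_space)

lemma lie_algebra_gh:
  assumes "alternating_bilinear sV sZ \<beta>"
  shows "lie_algebra (module_prod.scale sV sZ) (gh_bracket \<beta>)"
proof -
  have vs: "vector_space sV" "vector_space sZ"
    using assms by (auto simp: alternating_bilinear_def vs_linear_iff)
  interpret V: vector_space sV by (rule vs)
  interpret Z: vector_space sZ by (rule vs)
  interpret VZ: vector_space_prod sV sZ ..
  show ?thesis
  proof
    have "\<beta> 0 w = 0" "\<beta> v 0 = 0" for v w
    proof -
      have "\<beta> (0 + 0) w = \<beta> 0 w + \<beta> 0 w" "\<beta> v (0 + 0) = \<beta> v 0 + \<beta> v 0"
        using assms unfolding alternating_bilinear_def vs_linear_iff by blast+
      then show "\<beta> 0 w = 0" "\<beta> v 0 = 0" by auto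
    qed
    then show "gh_bracket \<beta> x (gh_bracket \<beta> y z) + gh_bracket \<beta> y (gh_bracket \<beta> z x) +
        gh_bracket \<beta> z (gh_bracket \<beta> x y) = 0" for x y z
      by (auto simp: gh_bracket_def zero_prod_def split: prod.splits)
    show "alternating_bilinear (module_prod.scale sV sZ) (module_prod.scale sV sZ) (gh_bracket \<beta>)"
      using assms VZ.p.vector_space_axioms
      by (auto simp: alternating_bilinear_def vs_linear_iff gh_bracket_def VZ.scale_def zero_prod_def
          split: prod.splits)
  qed
qed

lemma lie_algebra_prod:
  assumes "lie_algebra s1 br1" "lie_algebra s2 br2"
  shows "lie_algebra (module_prod.scale s1 s2) (prod_bracket br1 br2)"
proof -
  interpret L1: lie_algebra s1 br1 by fact
  interpret L2: lie_algebra s2 br2 by fact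
  interpret P: vector_space_prod s1 s2 ..
  show ?thesis
  proof
    show "prod_bracket br1 br2 x (prod_bracket br1 br2 y z) +
        prod_bracket br1 br2 y (prod_bracket br1 br2 z x) +
        prod_bracket br1 br2 z (prod_bracket br1 br2 x y) = 0" for x y z
      by (auto simp: prod_bracket_def zero_prod_def L1.jacobi L2.jacobi split: prod.splits)
    show "alternating_bilinear (module_prod.scale s1 s2) (module_prod.scale s1 s2)
        (prod_bracket br1 br2)"
      using L1.alternating_bilinear_bracket L2.alternating_bilinear_bracket
        P.p.vector_space_axioms
      by (auto simp: alternating_bilinear_def vs_linear_iff prod_bracket_def P.scale_def zero_prod_def
          split: prod.splits)
  qed
qed

end

theory Submission
  imports Defs
begin

text \<open>
  An automorphism maps the center \<open>Z \<times> A\<close> and the derived algebra \<open>Z\<close> of \<open>gh(V, Z, \<beta>) \<times> A\<close> onto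
  themselves, so it is block triangular, and its diagonal blocks \<open>\<sigma>\<close>, \<open>\<rho>\<close>, \<open>\<alpha>\<close> are invertible.
  The only remaining condition for such a map to preserve brackets is \<open>\<rho> (\<beta> u v) = \<beta> (\<sigma> u) (\<sigma> v)\<close>,
  and a bijection \<open>\<sigma>\<close> admits a \<open>\<rho> \<in> GL(Z)\<close> with this property exactly if it belongs to \<open>\<Sigma>\<^sub>\<beta>\<close>;
  then \<open>\<rho> = \<sigma>'\<close>.
\<close>

section \<open>Linear bijections and their lifts to the free vector space\<close>

lemma GL_iff:
  "f \<in> GL s \<longleftrightarrow> vector_space s \<and> (\<forall>x y. f (x + y) = f x + f y) \<and>
     (\<forall>c x. f (s c x) = s c (f x)) \<and> (\<forall>x. f x = 0 \<longrightarrow> x = 0) \<and> surj f"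
proof (cases "Vector_Spaces.linear s s f")
  case True
  then interpret f: Vector_Spaces.linear s s f .
  show ?thesis
    using True by (auto simp: GL_def bij_def vs_linear_iff f.inj_iff_eq_0)
qed (auto simp: GL_def vs_linear_iff)

lemma GL_surjE:
  assumes "f \<in> GL s"
  obtains x where "f x = y"
  using assms unfolding GL_def by (metis (mono_tags, lifting) bij_pointE mem_Collect_eq)

lemma vs_linear_0: "Vector_Spaces.linear s1 s2 f \<Longrightarrow> f 0 = 0"
  unfolding vs_linear_iff by (metis add_cancel_right_right)

text \<open>The lift of \<open>inv \<sigma>\<close> is a right inverse: the composite fixes every
  generator, and generators determine linear maps on the free space.\<close>

lemma free_lift_gen_surj:
  fixes \<sigma> :: "'v \<Rightarrow> 'v"
  assumes "surj \<sigma>"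
  shows "surj (free_lift free_scale (\<lambda>(v, w). free_gen (\<sigma> v) (\<sigma> w) :: 'v \<times> 'v \<Rightarrow>\<^sub>0 'k::field))"
    (is "surj ?S")
proof (rule surjI)
  fix x :: "'v \<times> 'v \<Rightarrow>\<^sub>0 'k"
  let ?S' = "free_lift free_scale (\<lambda>(v, w). free_gen (inv \<sigma> v) (inv \<sigma> w) :: 'v \<times> 'v \<Rightarrow>\<^sub>0 'k)"
  have "(?S \<circ> ?S') x = id x"
  proof (rule linear_free_eqI[where f = "?S \<circ> ?S'" and g = id and sT = free_scale])
    show "Vector_Spaces.linear free_scale free_scale (?S \<circ> ?S')"
      by (rule Vector_Spaces.linear_compose[OF free.linear_free_lift free.linear_free_lift])
    show "Vector_Spaces.linear free_scale free_scale (id :: ('v \<times> 'v \<Rightarrow>\<^sub>0 'k) \<Rightarrow> _)"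
      by (rule free.linear_id)
  qed (auto simp: split_paired_all surj_f_inv_f[OF assms])
  then show "?S (?S' x) = x" by simp
qed

section \<open>Membership in \<Sigma> and the induced map on Z\<close>

context reduced_heisenberg
begin

text \<open>Converse of \<open>ex1_sigma_prime\<close>. On the free space,
  \<open>B \<circ> S\<close> and \<open>\<rho> \<circ> B\<close> agree on generators. As \<rho> is
  injective, \<open>S\<close> preserves and reflects \<open>B x = 0\<close>; as \<open>S\<close> is
  onto, it maps the kernel of \<open>B\<close> onto itself. Passing to cosets gives the
  claim.\<close>

lemma Sigma_groupI:
  assumes \<sigma>: "\<sigma> \<in> GL sV" and \<rho>: "\<rho> \<in> GL sZ" and comm: "\<And>u v. \<rho> (\<beta> u v) = \<beta> (\<sigma> u) (\<sigma> v)"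
  shows "\<sigma> \<in> Sigma_group sV sZ \<beta>"
proof -
  have lin: "Vector_Spaces.linear sV sV \<sigma>" and "surj \<sigma>"
    using \<sigma> by (auto simp: GL_def bij_is_surj)
  define B where "B = free_lift sZ (\<lambda>(v, w). \<beta> v w)"
  define S :: "('v \<times> 'v \<Rightarrow>\<^sub>0 'k) \<Rightarrow> _" where
    "S = free_lift free_scale (\<lambda>(v, w). free_gen (\<sigma> v) (\<sigma> w))"
  have linB: "Vector_Spaces.linear free_scale sZ B"
    unfolding B_def by (rule Z.linear_free_lift)
  have linS: "Vector_Spaces.linear free_scale free_scale S"
    unfolding S_def by (rule free.linear_free_lift)
  interpret \<rho>: Vector_Spaces.linear sZ sZ \<rho> using \<rho> by (simp add: GL_def)
  have "surj S"
    unfolding S_def by (rule free_lift_gen_surj[OF \<open>surj \<sigma>\<close>])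
  have "(B \<circ> S) x = (\<rho> \<circ> B) x" for x
  proof (rule linear_free_eqI[where f = "B \<circ> S" and g = "\<rho> \<circ> B" and sT = sZ])
    show "Vector_Spaces.linear free_scale sZ (B \<circ> S)"
      by (rule Vector_Spaces.linear_compose[OF linS linB])
    show "Vector_Spaces.linear free_scale sZ (\<rho> \<circ> B)"
      by (rule Vector_Spaces.linear_compose[OF linB \<rho>.linear_axioms])
  qed (auto simp: split_paired_all B_def S_def comm)
  then have BS: "B (S x) = 0 \<longleftrightarrow> B x = 0" for x
    using \<rho> by (auto simp: GL_iff \<rho>.zero)
  have ker: "ker_hat sV sZ \<beta> = (\<lambda>x. x +o ext_null sV) ` {x. B x = 0}"
    by (auto simp: ker_hat_def ext_space_def B_def hat_coset[OF alternating_bilinear])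
  have "ext_map sV \<sigma> ` ker_hat sV sZ \<beta> = (\<lambda>x. x +o ext_null sV) ` S ` {x. B x = 0}"
    unfolding ker image_image by (simp add: ext_map_coset[OF lin] S_def)
  \<comment> \<open>Every preimage under \<open>S\<close> of a kernel element lies in the kernel by
    \<open>BS\<close>.\<close>
  also have "S ` {x. B x = 0} = {x. B x = 0}"
    using \<open>surj S\<close> BS by (auto simp: image_iff) (metis surjD)
  finally show ?thesis
    using \<sigma> ker by (simp add: Sigma_group_def)
qed

lemma sigma_prime_eqI:
  assumes "\<sigma> \<in> GL sV" "\<rho> \<in> GL sZ" "\<And>u v. \<rho> (\<beta> u v) = \<beta> (\<sigma> u) (\<sigma> v)"
  shows "sigma_prime sZ \<beta> \<sigma> = \<rho>"
  unfolding sigma_prime_def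
  using ex1_sigma_prime[OF Sigma_groupI[OF assms]] assms(2,3) by (intro the1_equality) auto

lemma sigma_prime:
  assumes "\<sigma> \<in> Sigma_group sV sZ \<beta>"
  shows "sigma_prime sZ \<beta> \<sigma> \<in> GL sZ" "sigma_prime sZ \<beta> \<sigma> (\<beta> u v) = \<beta> (\<sigma> u) (\<sigma> v)"
  using theI'[OF ex1_sigma_prime[OF assms]] unfolding sigma_prime_def by auto

text \<open>Reduces claims about all of Z to the values of \<beta>; below it kills the block from Z
  to A and shows that \<rho> is onto.\<close>

lemma subspace_eq_UNIV:
  assumes "Z.subspace T" "\<And>v w. \<beta> v w \<in> T"
  shows "T = UNIV"
  using Z.span_minimal[of "{\<beta> v w | v w. True}" T] assms generates by auto

end

theorem proposition1p2:
  fixes sV :: "'k::field \<Rightarrow> 'v::ab_group_add \<Rightarrow> 'v"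
    and sZ :: "'k \<Rightarrow> 'z::ab_group_add \<Rightarrow> 'z"
    and sA :: "'k \<Rightarrow> 'a::ab_group_add \<Rightarrow> 'a"
    and \<beta> :: "'v \<Rightarrow> 'v \<Rightarrow> 'z"
    and brA :: "'a \<Rightarrow> 'a \<Rightarrow> 'a"
  assumes "reduced_heisenberg sV sZ \<beta>"
    and "abelian_lie_algebra sA brA"
  shows "lie_automorphisms (module_prod.scale (module_prod.scale sV sZ) sA)
           (prod_bracket (gh_bracket \<beta>) brA) =
         {\<lambda>((v, z), a). ((\<sigma> v, sigma_prime sZ \<beta> \<sigma> z + \<tau> v + \<zeta> a), \<alpha> a + \<xi> v) | \<sigma> \<tau> \<zeta> \<alpha> \<xi>.
            \<sigma> \<in> Sigma_group sV sZ \<beta> \<and>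
            Vector_Spaces.linear sV sZ \<tau> \<and>
            Vector_Spaces.linear sA sZ \<zeta> \<and>
            \<alpha> \<in> GL sA \<and>
            Vector_Spaces.linear sV sA \<xi>}"
proof -
  interpret reduced_heisenberg sV sZ \<beta> by fact
  interpret A: abelian_lie_algebra sA brA by fact
  interpret VZ: vector_space_prod sV sZ ..
  interpret VZA: vector_space_prod VZ.scale sA ..
  let ?s = "VZA.scale" and ?br = "prod_bracket (gh_bracket \<beta>) brA"
  have br [simp]: "?br ((v, z), a) ((w, y), b) = ((0, \<beta> v w), 0)" for v z a w y b
    by (simp add: prod_bracket_def gh_bracket_def A.abelian)
  have scale [simp]: "?s c ((v, z), a) = ((sV c v, sZ c z), sA c a)" for c v z a
    by (simp add: VZA.scale_def VZ.scale_def)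
  have \<beta>0 [simp]: "\<beta> 0 w = 0" "\<beta> v 0 = 0" for v w
    using alternating_bilinear vs_linear_0[of sV sZ "\<lambda>v. \<beta> v w"] vs_linear_0[of sV sZ "\<beta> v"]
    by (auto simp: alternating_bilinear_def)
  show ?thesis
  proof (intro subset_antisym subsetI)

    \<comment> \<open>Every automorphism has the stated form\<close>
    fix \<phi> assume "\<phi> \<in> lie_automorphisms ?s ?br"
    then have \<phi>: "\<phi> \<in> GL ?s" and hom: "\<phi> (?br x y) = ?br (\<phi> x) (\<phi> y)" for x y
      unfolding lie_automorphisms_def by blast+
    from \<phi> interpret \<phi>: Vector_Spaces.linear ?s ?s \<phi> by (simp add: GL_def)
    have ker: "\<phi> x = 0 \<longleftrightarrow> x = 0" for x
      using \<phi> \<phi>.zero \<phi>.inj_iff_eq_0 unfolding GL_def by (blast dest: bij_is_inj)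
    have "surj \<phi>"
      using \<phi> unfolding GL_def by (blast dest: bij_is_surj)
    \<comment> \<open>Six of the nine blocks of \<phi>. The other three, Z to V, A to V and Z to A,
      are shown to vanish by \<open>central\<close> and \<open>derived\<close>.\<close>
    define \<sigma> where "\<sigma> v = fst (fst (\<phi> ((v, 0), 0)))" for v
    define \<tau> where "\<tau> v = snd (fst (\<phi> ((v, 0), 0)))" for v
    define \<xi> where "\<xi> v = snd (\<phi> ((v, 0), 0))" for v
    define \<rho> where "\<rho> z = snd (fst (\<phi> ((0, z), 0)))" for z
    define \<zeta> where "\<zeta> a = snd (fst (\<phi> ((0, 0), a)))" for a
    define \<alpha> where "\<alpha> a = snd (\<phi> ((0, 0), a))" for a
    have add: "\<phi> ((v + w, z + y), a + b) = \<phi> ((v, z), a) + \<phi> ((w, y), b)" for v w z y a b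
      by (simp flip: \<phi>.add)
    have scl: "\<phi> ((sV c v, sZ c z), sA c a) = ?s c (\<phi> ((v, z), a))" for c v z a
      by (simp flip: \<phi>.scale)
    have fst_s: "fst (?s c x) = VZ.scale c (fst x)" "snd (?s c x) = sA c (snd x)"
      "fst (VZ.scale c p) = sV c (fst p)" "snd (VZ.scale c p) = sZ c (snd p)" for c x p
      by (auto simp: VZA.scale_def VZ.scale_def split: prod.splits)
    note comps = \<sigma>_def \<tau>_def \<xi>_def \<rho>_def \<zeta>_def \<alpha>_def
    have lin: "Vector_Spaces.linear sV sV \<sigma>" "Vector_Spaces.linear sV sZ \<tau>"
      "Vector_Spaces.linear sV sA \<xi>" "Vector_Spaces.linear sZ sZ \<rho>"
      "Vector_Spaces.linear sA sZ \<zeta>" "Vector_Spaces.linear sA sA \<alpha>"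
      \<comment> \<open>Zeros in two of the three coordinates restrict \<phi> to a single
        factor.\<close>
      using add[of _ _ 0 0 0 0] add[of 0 0 _ _ 0 0] add[of 0 0 0 0]
        scl[of _ _ 0 0] scl[of _ 0 _ 0] scl[of _ 0 0]
      by (simp_all add: vs_linear_iff comps fst_s
          V.vector_space_axioms Z.vector_space_axioms A.vector_space_axioms)
    interpret \<rho>: Vector_Spaces.linear sZ sZ \<rho> by (rule lin)
    \<comment> \<open>By nondegeneracy the center consists of the elements with zero V-component,
      and a bijective homomorphism preserves and reflects centrality.\<close>
    have central: "fst (fst (\<phi> x)) = 0 \<longleftrightarrow> fst (fst x) = 0" for x
    proof -
      have center: "fst (fst x) = 0 \<longleftrightarrow> (\<forall>y. ?br x y = 0)" for x
      proof -
        have "v = 0 \<longleftrightarrow> (\<forall>w. \<beta> v w = 0)" for v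
          using nondegenerate by blast
        then show ?thesis
          by (cases x) (auto simp: split_paired_all zero_prod_def)
      qed
      have "(\<forall>y. ?br x y = 0) \<longleftrightarrow> (\<forall>y. ?br (\<phi> x) (\<phi> y) = 0)"
        by (simp add: ker flip: hom)
      also have "\<dots> \<longleftrightarrow> (\<forall>y. ?br (\<phi> x) y = 0)"
        using \<open>surj \<phi>\<close> by (metis surjD)
      finally show ?thesis unfolding center ..
    qed
    have bracket: "\<phi> ((0, \<beta> u v), 0) = ((0, \<beta> (\<sigma> u) (\<sigma> v)), 0)" for u v
      using hom[of "((u, 0), 0)" "((v, 0), 0)"]
      by (cases "\<phi> ((u, 0), 0)"; cases "\<phi> ((v, 0), 0)") (auto simp: \<sigma>_def)
    \<comment> \<open>Brackets have zero A-component because A is abelian, so the block from Z to A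
      vanishes on all values of \<beta>.\<close>
    have "{z. snd (\<phi> ((0, z), 0)) = 0} = UNIV"
    proof (rule subspace_eq_UNIV)
      show "Z.subspace {z. snd (\<phi> ((0, z), 0)) = 0}"
        using add[of 0 0 _ _ 0 0] scl[of _ 0 _ 0] \<phi>.zero
        by (intro Z.subspaceI) (auto simp: fst_s zero_prod_def)
    qed (simp add: bracket)
    then have derived: "\<phi> ((0, z), 0) = ((0, \<rho> z), 0)" for z
      using central[of "((0, z), 0)"] by (auto simp: \<rho>_def prod_eq_iff)
    have \<phi>A: "\<phi> ((0, 0), a) = ((0, \<zeta> a), \<alpha> a)" for a
      using central[of "((0, 0), a)"] by (auto simp: \<zeta>_def \<alpha>_def prod_eq_iff)
    have \<phi>_eq: "\<phi> ((v, z), a) = ((\<sigma> v, \<rho> z + \<tau> v + \<zeta> a), \<alpha> a + \<xi> v)" for v z a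
    proof -
      have "\<phi> ((v, z), a) = \<phi> ((v, 0), 0) + \<phi> ((0, z), 0) + \<phi> ((0, 0), a)"
        by (simp flip: add)
      moreover have "\<phi> ((v, 0), 0) = ((\<sigma> v, \<tau> v), \<xi> v)"
        by (simp add: \<sigma>_def \<tau>_def \<xi>_def)
      ultimately show ?thesis
        by (simp add: derived \<phi>A algebra_simps)
    qed
    have surj: "\<exists>v z a. ((\<sigma> v, \<rho> z + \<tau> v + \<zeta> a), \<alpha> a + \<xi> v) = y" for y
    proof -
      obtain x where "y = \<phi> x"
        using \<open>surj \<phi>\<close> by (rule surjE)
      then show ?thesis
        by (cases x rule: prod.exhaust; cases "fst x") (auto simp: \<phi>_eq)
    qed
    have comm: "\<rho> (\<beta> u v) = \<beta> (\<sigma> u) (\<sigma> v)" for u v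
      using bracket[of u v] by (simp add: derived)
    have "\<exists>v. w = \<sigma> v" for w
      using surj[of "((w, 0), 0)"] by auto
    then have "surj \<sigma>"
      by (simp add: surj_def)
    \<comment> \<open>Here \<phi> sends \<open>((v, 0), 0)\<close> into the center, so this element
      is itself central.\<close>
    moreover have "v = 0" if "\<sigma> v = 0" for v
      using central[of "((v, 0), 0)"] that by (simp add: \<sigma>_def)
    ultimately have \<sigma>: "\<sigma> \<in> GL sV"
      using lin(1) by (simp add: GL_iff vs_linear_iff)
    have "range \<rho> = UNIV"
    proof (rule subspace_eq_UNIV)
      show "Z.subspace (range \<rho>)"
        by (rule \<rho>.subspace_image) (rule Z.subspace_UNIV)
      \<comment> \<open>Take preimages of v and w under \<sigma> and apply
        \<open>comm\<close>.\<close>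
      show "\<beta> v w \<in> range \<rho>" for v w
        using \<open>surj \<sigma>\<close> by (metis comm rangeI surjD)
    qed
    moreover have "z = 0" if "\<rho> z = 0" for z
      using ker[of "((0, z), 0)"] that by (simp add: derived zero_prod_def)
    ultimately have \<rho>: "\<rho> \<in> GL sZ"
      using lin(4) by (simp add: GL_iff vs_linear_iff)
    \<comment> \<open>The image of \<open>((0, 0), a)\<close> need not be zero, as \<zeta>
      contributes in Z; a suitable z cancels this contribution and yields an element of the kernel
      of \<phi>.\<close>
    have "a = 0" if "\<alpha> a = 0" for a
    proof -
      obtain z where "\<rho> z = - \<zeta> a"
        using \<open>range \<rho> = UNIV\<close> by (metis surjD)
      then have "\<phi> ((0, z), a) = 0"
        using that by (simp add: \<phi>_eq zero_prod_def vs_linear_0[OF lin(1)] vs_linear_0[OF lin(2)]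
            vs_linear_0[OF lin(3)])
      then show ?thesis
        unfolding ker by (simp add: zero_prod_def)
    qed
    moreover have "surj \<alpha>"
    proof -
      have "\<exists>a. b = \<alpha> a" for b
      proof -
        \<comment> \<open>A preimage of \<open>((0, 0), b)\<close> has v = 0 since \<sigma> is
          injective, so \<xi> contributes nothing to b.\<close>
        obtain v z a where "((\<sigma> v, \<rho> z + \<tau> v + \<zeta> a), \<alpha> a + \<xi> v) = ((0, 0), b)"
          using surj by blast
        then have "\<sigma> v = 0" "\<alpha> a + \<xi> v = b" by auto
        moreover from this have "v = 0" using \<sigma> by (simp add: GL_iff)
        ultimately show ?thesis
          using vs_linear_0[OF lin(3)] by auto
      qed
      then show ?thesis by (simp add: surj_def)
    qed
    ultimately have \<alpha>: "\<alpha> \<in> GL sA"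
      using lin(6) by (simp add: GL_iff vs_linear_iff)
    have "\<phi> = (\<lambda>((v, z), a). ((\<sigma> v, sigma_prime sZ \<beta> \<sigma> z + \<tau> v + \<zeta> a), \<alpha> a + \<xi> v))"
      unfolding sigma_prime_eqI[OF \<sigma> \<rho> comm] by (auto simp: \<phi>_eq)
    with lin Sigma_groupI[OF \<sigma> \<rho> comm] \<alpha>
    show "\<phi> \<in> {\<lambda>((v, z), a). ((\<sigma> v, sigma_prime sZ \<beta> \<sigma> z + \<tau> v + \<zeta> a), \<alpha> a + \<xi> v) | \<sigma> \<tau> \<zeta> \<alpha> \<xi>.
        \<sigma> \<in> Sigma_group sV sZ \<beta> \<and> Vector_Spaces.linear sV sZ \<tau> \<and>
        Vector_Spaces.linear sA sZ \<zeta> \<and> \<alpha> \<in> GL sA \<and> Vector_Spaces.linear sV sA \<xi>}"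
      by blast
  next

    \<comment> \<open>Every map of the stated form is an automorphism\<close>
    fix \<phi>
    assume "\<phi> \<in> {\<lambda>((v, z), a). ((\<sigma> v, sigma_prime sZ \<beta> \<sigma> z + \<tau> v + \<zeta> a), \<alpha> a + \<xi> v) | \<sigma> \<tau> \<zeta> \<alpha> \<xi>.
        \<sigma> \<in> Sigma_group sV sZ \<beta> \<and> Vector_Spaces.linear sV sZ \<tau> \<and>
        Vector_Spaces.linear sA sZ \<zeta> \<and> \<alpha> \<in> GL sA \<and> Vector_Spaces.linear sV sA \<xi>}"
    then obtain \<sigma> \<tau> \<zeta> \<alpha> \<xi> where
      \<phi>: "\<phi> = (\<lambda>((v, z), a). ((\<sigma> v, sigma_prime sZ \<beta> \<sigma> z + \<tau> v + \<zeta> a), \<alpha> a + \<xi> v))"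
      and \<Sigma>: "\<sigma> \<in> Sigma_group sV sZ \<beta>" and \<tau>: "Vector_Spaces.linear sV sZ \<tau>"
      and \<zeta>: "Vector_Spaces.linear sA sZ \<zeta>" and \<alpha>: "\<alpha> \<in> GL sA"
      and \<xi>: "Vector_Spaces.linear sV sA \<xi>"
      by blast
    define \<rho> where "\<rho> = sigma_prime sZ \<beta> \<sigma>"
    have \<sigma>: "\<sigma> \<in> GL sV" and \<rho>: "\<rho> \<in> GL sZ" and comm: "\<rho> (\<beta> u v) = \<beta> (\<sigma> u) (\<sigma> v)" for u v
      using \<Sigma> sigma_prime[OF \<Sigma>] by (auto simp: Sigma_group_def \<rho>_def)
    have \<phi>_eq: "\<phi> ((v, z), a) = ((\<sigma> v, \<rho> z + \<tau> v + \<zeta> a), \<alpha> a + \<xi> v)" for v z a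
      by (simp add: \<phi> \<rho>_def)
    have zero: "\<sigma> 0 = 0" "\<tau> 0 = 0" "\<zeta> 0 = 0" "\<alpha> 0 = 0" "\<xi> 0 = 0"
      using \<sigma> \<alpha> vs_linear_0 \<tau> \<zeta> \<xi> unfolding GL_def by blast+
    have "surj \<phi>"
    proof -
      have "\<exists>x. ((w, y), b) = \<phi> x" for w y b
      proof -
        \<comment> \<open>Back substitution in the order V, A, Z, in which \<phi> is block
          triangular; the kernel computation below follows the same order.\<close>
        obtain v where "\<sigma> v = w" using \<sigma> by (rule GL_surjE)
        moreover obtain a where "\<alpha> a = b - \<xi> v" using \<alpha> by (rule GL_surjE)
        moreover obtain z where "\<rho> z = y - \<tau> v - \<zeta> a" using \<rho> by (rule GL_surjE)
        ultimately have "((w, y), b) = \<phi> ((v, z), a)" by (simp add: \<phi>_eq)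
        then show ?thesis by (rule exI)
      qed
      then show ?thesis by (simp add: surj_def split_paired_all)
    qed
    moreover have "x = 0" if "\<phi> x = 0" for x
    proof -
      obtain v z a where x: "x = ((v, z), a)" by (metis prod.exhaust)
      with that have eq: "\<sigma> v = 0" "\<rho> z + \<tau> v + \<zeta> a = 0" "\<alpha> a + \<xi> v = 0"
        by (auto simp: \<phi>_eq zero_prod_def)
      then have "v = 0" using \<sigma> by (simp add: GL_iff)
      moreover from this have "a = 0" using eq(3) \<alpha> by (simp add: GL_iff zero)
      moreover from calculation have "z = 0" using eq(2) \<rho> by (simp add: GL_iff zero)
      ultimately show ?thesis by (simp add: x zero_prod_def)
    qed
    moreover have "\<phi> (x + y) = \<phi> x + \<phi> y" for x y
      using \<sigma> \<rho> \<alpha> \<tau> \<zeta> \<xi>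
      by (cases x; cases y) (auto simp: GL_iff vs_linear_iff \<phi>_eq split_paired_all)
    moreover have "\<phi> (?s c x) = ?s c (\<phi> x)" for c x
      using \<sigma> \<rho> \<alpha> \<tau> \<zeta> \<xi>
      by (cases x) (auto simp: GL_iff vs_linear_iff \<phi>_eq split_paired_all
          Z.scale_right_distrib A.scale_right_distrib)
    ultimately have "\<phi> \<in> GL ?s"
      using VZA.p.vector_space_axioms by (simp add: GL_iff)
    \<comment> \<open>The bracket depends only on the V-components, on which \<phi> acts by
      \<sigma>, and lies in Z, where \<phi> acts by \<rho>; so \<open>comm\<close> is the whole
      condition.\<close>
    moreover have "\<phi> (?br x y) = ?br (\<phi> x) (\<phi> y)" for x y
      by (cases x; cases y) (auto simp: \<phi>_eq split_paired_all zero comm)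
    ultimately show "\<phi> \<in> lie_automorphisms ?s ?br"
      unfolding lie_automorphisms_def by blast
  qed
qed

end
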